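(* Let $\nu : \mathbb{R}^d \to \mathbb{R}_+$ be a normalization function and let ¢ be the associated Capra-coupling on $\mathbb{R}^d\times\mathbb{R}^d$, written $c_\nu$. For any 0-homogeneous function $f : \mathbb{R}^d \to \overline{\mathbb{R}}$, one has $$ f^{c_\nu} = \bigl( f \dotplus \delta_{B_\nu} \bigr)^{\star} = \bigl( f \dotplus \delta_{S_\nu^{(0)}} \bigr)^{\star} , $$ where $f^{c_\nu}$ is the $c_\nu$-Fenchel-Moreau conjugate of $f$ and $(\cdot)^\star$ is the Fenchel conjugate.
   Context: $d$ is a positive integer, $\mathbb{R}^d$ has scalar product $\langle\cdot,\cdot\rangle$, and $\overline{\mathbb{R}}=[-\infty,+\infty]$. The Moreau upper addition $\dotplus$ extends the usual addition with $(+\infty)\dotplus(-\infty)=(-\infty)\dotplus(+\infty)=+\infty$; the Moreau lower addition, written $+_{\ell}$, extends it with $(+\infty)+_{\ell}(-\infty)=(-\infty)+_{\ell}(+\infty)=-\infty$. For $W\subset\mathbb{R}^d$, $\delta_W(w)=0$ if $w\in W$ and $+\infty$ otherwise. A function $f:\mathbb{R}^d\to\overline{\mathbb{R}}$ is 0-homogeneous if $f(\rho x)=f(x)$ for all $\rho\in\mathbb{R}\setminus\{0\}$ and all $x\in\mathbb{R}^d$. A normalization function is a function $\nu:\mathbb{R}^d\to\mathbb{R}_+$ that is absolutely 1-homogeneous ($\nu(\rho x)=|\rho|\nu(x)$ for all $\rho\in\mathbb{R}\setminus\{0\}$, $x\in\mathbb{R}^d$) and such that $\nu(x)=0$ if and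 only if $x=0$ (subadditivity is not required). Set $S_\nu=\{x:\nu(x)=1\}$, $S_\nu^{(0)}=S_\nu\cup\{0\}$, $B_\nu=\{x:\nu(x)\le 1\}$. The Capra-coupling associated with $\nu$ is $c_\nu:\mathbb{R}^d\times\mathbb{R}^d\to\mathbb{R}$, $c_\nu(x,y)=\langle x,y\rangle/\nu(x)$ if $x\ne 0$, and $c_\nu(0,y)=0$. The $c_\nu$-Fenchel-Moreau conjugate is $f^{c_\nu}(y)=\sup_{x\in\mathbb{R}^d}\bigl(c_\nu(x,y)+_{\ell}(-f(x))\bigr)$ for $y \in\mathbb{R}^d$. The Fenchel conjugate is $f^\star(y)=\sup_{x\in\mathbb{R}^d}\bigl(\langle x,y\rangle+_{\ell}(-f(x))\bigr)$ for $y\in\mathbb{R}^d$. *)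

theory Defs
  imports "HOL-Analysis.Analysis"
begin

text \<open>
  The Moreau upper addition on the extended reals is the addition of type \<^typ>\<open>ereal\<close>:
  it resolves both indeterminate sums to \<open>\<infinity>\<close>.
\<close>

lemma ereal_add_is_moreau_upper:
  "(\<infinity>::ereal) + (-\<infinity>) = \<infinity>"
  "(-\<infinity>::ereal) + \<infinity> = \<infinity>"
  by simp_all

definition moreau_lower_add :: "ereal \<Rightarrow> ereal \<Rightarrow> ereal"  (infixl "+\<^sub>l" 65)
  where "a +\<^sub>l b = (if a = -\<infinity> \<or> b = -\<infinity> then -\<infinity> else a + b)"

definition delta :: "'a set \<Rightarrow> 'a \<Rightarrow> ereal"
  where "delta W w = (if w \<in> W then 0 else \<infinity>)"

definition zero_homogeneous :: "(real ^ 'n \<Rightarrow> ereal) \<Rightarrow> bool"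
  where "zero_homogeneous f \<longleftrightarrow> (\<forall>\<rho> x. \<rho> \<noteq> 0 \<longrightarrow> f (\<rho> *\<^sub>R x) = f x)"

definition normalization_function :: "(real ^ 'n \<Rightarrow> real) \<Rightarrow> bool"
  where "normalization_function \<nu> \<longleftrightarrow>
    (\<forall>x. 0 \<le> \<nu> x) \<and>
    (\<forall>\<rho> x. \<rho> \<noteq> 0 \<longrightarrow> \<nu> (\<rho> *\<^sub>R x) = \<bar>\<rho>\<bar> * \<nu> x) \<and>
    (\<forall>x. \<nu> x = 0 \<longleftrightarrow> x = 0)"

definition unit_sphere :: "(real ^ 'n \<Rightarrow> real) \<Rightarrow> (real ^ 'n) set"
  where "unit_sphere \<nu> = {x. \<nu> x = 1}"

definition unit_sphere0 :: "(real ^ 'n \<Rightarrow> real) \<Rightarrow> (real ^ 'n) set"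
  where "unit_sphere0 \<nu> = unit_sphere \<nu> \<union> {0}"

definition unit_ball :: "(real ^ 'n \<Rightarrow> real) \<Rightarrow> (real ^ 'n) set"
  where "unit_ball \<nu> = {x. \<nu> x \<le> 1}"

definition capra_coupling :: "(real ^ 'n \<Rightarrow> real) \<Rightarrow> real ^ 'n \<Rightarrow> real ^ 'n \<Rightarrow> real"
  where "capra_coupling \<nu> x y = (if x = 0 then 0 else (x \<bullet> y) / \<nu> x)"

definition fenchel_moreau_conjugate ::
    "(real ^ 'n \<Rightarrow> real ^ 'n \<Rightarrow> real) \<Rightarrow> (real ^ 'n \<Rightarrow> ereal) \<Rightarrow> real ^ 'n \<Rightarrow> ereal"
  where "fenchel_moreau_conjugate c f y = (SUP x. ereal (c x y) +\<^sub>l (- f x))"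

definition fenchel_conjugate :: "(real ^ 'n \<Rightarrow> ereal) \<Rightarrow> real ^ 'n \<Rightarrow> ereal"
  where "fenchel_conjugate f y = (SUP x. ereal (x \<bullet> y) +\<^sub>l (- f x))"

end

theory Submission
  imports Defs
begin

text \<open>
  Both restricted conjugates are suprema of \<open>\<langle>x, y\<rangle> - f x\<close> over the constraint set. Normalising
  a nonzero \<open>x\<close> moves it to the unit sphere without changing \<open>f x\<close>, which turns the scalar product
  into the Capra-coupling. Conversely, if \<open>0 < \<nu> x \<le> 1\<close>, then \<open>\<langle>x, y\<rangle>\<close> is at most the coupling
  of \<open>x\<close> or of \<open>-x\<close> with \<open>y\<close>, and \<open>f (-x) = f x\<close>.
\<close>

text \<open>The two Moreau additions differ only on sums of opposite infinities, which a real first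
  summand excludes. Both conjugates have such a summand, so ordinary \<open>ereal\<close> arithmetic
  suffices from here on.\<close>

lemma ereal_moreau_lower_add [simp]: "ereal a +\<^sub>l b = ereal a + b"
  by (cases b) (simp_all add: moreau_lower_add_def)

lemma fenchel_conjugate_add_delta:
  "fenchel_conjugate (\<lambda>x. f x + delta W x) y = (SUP x\<in>W. ereal (x \<bullet> y) - f x)"
proof (rule antisym)
  show "fenchel_conjugate (\<lambda>x. f x + delta W x) y \<le> (SUP x\<in>W. ereal (x \<bullet> y) - f x)"
    unfolding fenchel_conjugate_def
  proof (rule SUP_least)
    fix x
    show "ereal (x \<bullet> y) +\<^sub>l - (f x + delta W x) \<le> (SUP x\<in>W. ereal (x \<bullet> y) - f x)"
      \<comment> \<open>Off \<open>W\<close>, upper addition gives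
        \<open>f x + \<infinity> = \<infinity>\<close> even when \<open>f x = -\<infinity>\<close>,
        so the term is \<open>-\<infinity>\<close> and cannot raise the supremum.\<close>
      by (cases "x \<in> W") (auto simp: delta_def minus_ereal_def intro: SUP_upper2)
  qed
  show "(SUP x\<in>W. ereal (x \<bullet> y) - f x) \<le> fenchel_conjugate (\<lambda>x. f x + delta W x) y"
    unfolding fenchel_conjugate_def
  proof (rule SUP_least)
    fix x assume "x \<in> W"
    then show "ereal (x \<bullet> y) - f x \<le> (SUP x. ereal (x \<bullet> y) +\<^sub>l - (f x + delta W x))"
      by (intro SUP_upper2[of x]) (auto simp: delta_def minus_ereal_def)
  qed
qed

lemma unit_sphere0_subset_unit_ball:
  assumes "normalization_function \<nu>"
  shows "unit_sphere0 \<nu> \<subseteq> unit_ball \<nu>"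
proof -
  have "\<nu> 0 = 0"
    using assms by (simp add: normalization_function_def)
  then show ?thesis
    by (auto simp: unit_sphere0_def unit_sphere_def unit_ball_def)
qed

lemma capra_conjugate_le_sphere:
  assumes \<nu>: "normalization_function \<nu>" and f: "zero_homogeneous f"
  shows "fenchel_moreau_conjugate (capra_coupling \<nu>) f y
    \<le> (SUP x\<in>unit_sphere0 \<nu>. ereal (x \<bullet> y) - f x)"
  unfolding fenchel_moreau_conjugate_def
proof (rule SUP_least)
  fix x
  show "ereal (capra_coupling \<nu> x y) +\<^sub>l - f x \<le> (SUP x\<in>unit_sphere0 \<nu>. ereal (x \<bullet> y) - f x)"
  proof (cases "x = 0")
    \<comment> \<open>The origin cannot be normalised. It is its own witness, which is why 0 is
      adjoined to the sphere: the coupling and the scalar product both vanish there.\<close>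
    case True
    then show ?thesis
      by (intro SUP_upper2[of 0]) (auto simp: unit_sphere0_def capra_coupling_def minus_ereal_def)
  next
    case False
    then have pos: "\<nu> x > 0"
      using \<nu> by (metis normalization_function_def order_le_less)
    let ?u = "inverse (\<nu> x) *\<^sub>R x"
    have "\<nu> ?u = \<bar>inverse (\<nu> x)\<bar> * \<nu> x"
      using \<nu> False by (simp add: normalization_function_def)
    then have "?u \<in> unit_sphere0 \<nu>"
      using pos by (simp add: unit_sphere0_def unit_sphere_def)
    moreover have "f ?u = f x"
      using f pos by (simp add: zero_homogeneous_def)
    ultimately show ?thesis
      using False by (intro SUP_upper2[of ?u])
        (auto simp: capra_coupling_def minus_ereal_def divide_inverse mult.commute)
  qed
qed

lemma ball_le_capra_conjugate:
  assumes \<nu>: "normalization_function \<nu>" and f: "zero_homogeneous f"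
  shows "(SUP x\<in>unit_ball \<nu>. ereal (x \<bullet> y) - f x)
    \<le> fenchel_moreau_conjugate (capra_coupling \<nu>) f y"
  unfolding fenchel_moreau_conjugate_def
proof (rule SUP_least)
  fix x assume x: "x \<in> unit_ball \<nu>"
  \<comment> \<open>Since \<open>f z = f x\<close>, only real numbers need comparing; adding the
    same, possibly infinite, \<open>- f x\<close> to both sides is monotone.\<close>
  obtain z where z: "x \<bullet> y \<le> capra_coupling \<nu> z y" "f z = f x"
  proof (cases "x = 0")
    case True
    then show ?thesis
      by (intro that[of x]) (auto simp: capra_coupling_def)
  next
    case False
    then have pos: "\<nu> x > 0"
      using \<nu> by (metis normalization_function_def order_le_less)
    have neg: "\<nu> (- x) = \<nu> x" "f (- x) = f x"
      using \<nu> f unfolding normalization_function_def zero_homogeneous_def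
      by (metis abs_neg_one mult_1 neg_equal_0_iff_equal scaleR_minus1_left zero_neq_one)+
    \<comment> \<open>Dividing by \<open>\<nu> x \<le> 1\<close> enlarges only nonnegative numbers,
      hence the absolute value. The right-hand side is the coupling at \<open>x\<close> or at
      \<open>- x\<close>, according to the sign of \<open>x \<bullet> y\<close>.\<close>
    have "\<bar>x \<bullet> y\<bar> \<le> \<bar>x \<bullet> y\<bar> / \<nu> x"
      using x pos by (simp add: unit_ball_def pos_le_divide_eq mult_left_le)
    then have "x \<bullet> y \<le> \<bar>x \<bullet> y\<bar> / \<nu> x"
      by linarith
    then show ?thesis
      using that[of x] that[of "- x"] False neg
      by (cases "x \<bullet> y \<ge> 0") (auto simp: capra_coupling_def)
  qed
  show "ereal (x \<bullet> y) - f x \<le> (SUP x. ereal (capra_coupling \<nu> x y) +\<^sub>l - f x)"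
    using z by (intro SUP_upper2[of z]) (auto simp: minus_ereal_def intro: add_right_mono)
qed

theorem proposition6:
  fixes \<nu> :: "real ^ 'n \<Rightarrow> real" and f :: "real ^ 'n \<Rightarrow> ereal"
  assumes "normalization_function \<nu>" and "zero_homogeneous f"
  shows "fenchel_moreau_conjugate (capra_coupling \<nu>) f
           = fenchel_conjugate (\<lambda>x. f x + delta (unit_ball \<nu>) x)
       \<and> fenchel_conjugate (\<lambda>x. f x + delta (unit_ball \<nu>) x)
           = fenchel_conjugate (\<lambda>x. f x + delta (unit_sphere0 \<nu>) x)"
proof -
  \<comment> \<open>This closes the cycle conjugate \<le> sphere \<le> ball \<le> conjugate, which
    forces both equalities.\<close>
  have "(SUP x\<in>unit_sphere0 \<nu>. ereal (x \<bullet> y) - f x) \<le> (SUP x\<in>unit_ball \<nu>. ereal (x \<bullet> y) - f x)" for y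
    by (intro SUP_subset_mono unit_sphere0_subset_unit_ball assms order_refl)
  with capra_conjugate_le_sphere[OF assms] ball_le_capra_conjugate[OF assms]
  show ?thesis
    unfolding fun_eq_iff fenchel_conjugate_add_delta by (meson order_antisym order_trans)
qed

end
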